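(* Let $P(z)$ be an algebraic polynomial of degree $3$ satisfying $P(1)=1$, whose roots, listed with multiplicity, are $-1$, $z_1$ and $z_2$, with $z_1,z_2\in\mathbb{C}$. Denote $A_1=F_1(z_1)$, $A_2=F_1(z_2)$, $B_1=F_3(z_1)$ and $B_2=F_3(z_2)$. Then the inequality $$|P(z)|^2+|P(-z)|^2\le 1\quad\text{for a.e. } z\in\mathbb{T}$$ holds if and only if $$\begin{cases}1-A_1A_2-B_1B_2\ge 0,\\ B_1+B_2=0.\end{cases}$$
   Context: Algebraic polynomials have complex coefficients, and $\mathbb{T}=\{z\in\mathbb{C}:|z|=1\}$ is the unit circle. For $w=x+iy\in\mathbb{C}\setminus\{1\}$ with $x,y\in\mathbb{R}$, define $$F_1(w)=F_1(x,y)=1+\frac{2x}{(x-1)^2+y^2},\qquad F_3(w)=F_3(x,y)=-\frac{2y}{(x-1)^2+y^2}.$$ The condition $P(1)=1$ guarantees that no root equals $1$. *)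

theory Defs
  imports "HOL-Analysis.Analysis" "HOL-Computational_Algebra.Polynomial"
begin

definition F1 :: "complex \<Rightarrow> real" where
  "F1 w = 1 + 2 * Re w / ((Re w - 1)\<^sup>2 + (Im w)\<^sup>2)"

definition F3 :: "complex \<Rightarrow> real" where
  "F3 w = - (2 * Im w / ((Re w - 1)\<^sup>2 + (Im w)\<^sup>2))"

(* Arc length on the unit circle, as a Borel measure on the complex plane concentrated on
   the circle (total mass 2 * pi): "AE z in circle_measure" is "for a.e. z on the circle". *)
definition circle_measure :: "complex measure" where
  "circle_measure = distr (restrict_space lborel {0..<2 * pi}) borel cis"

end

theory Submission
  imports Defs "HOL-Computational_Algebra.Fundamental_Theorem_Algebra"
begin

text \<open>
  Write \<open>z = c + i s\<close> for a point of the unit circle. For a root \<open>w\<close> the normalised factor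
  \<open>|z - w|\<^sup>2 / |1 - w|\<^sup>2\<close> is affine in \<open>c\<close> and \<open>s\<close>, and \<open>F1 w\<close> and \<open>F3 w\<close> are its coefficients:
  it equals \<open>A + ((1 - A) c + B s)\<close>, where passing from \<open>z\<close> to \<open>-z\<close> only changes the sign of the
  bracket. The root \<open>-1\<close> contributes the weights \<open>(1 + c) / 2\<close> and \<open>(1 - c) / 2\<close> to the two
  squares. In their sum the terms linear in \<open>A1\<close> and \<open>A2\<close> and the mixed terms
  \<open>A1 B2\<close> and \<open>A2 B1\<close> cancel, and \<open>c\<^sup>2 + s\<^sup>2 = 1\<close> leaves
  the identity of \<open>unit_circle_defect\<close>,
  \<open>1 - |P z|\<^sup>2 - |P (-z)|\<^sup>2 = s (s K - c L)\<close> with \<open>K = 1 - A1 A2 - B1 B2\<close> and \<open>L = B1 + B2\<close>.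

  The left side is continuous, so it is nonnegative almost everywhere on the circle exactly when
  it is nonnegative at every point (\<open>AE_circle_measure_nonneg_iff\<close>). The quadratic form
  \<open>s\<^sup>2 K - s c L\<close> has no \<open>c\<^sup>2\<close> term, so it is nonnegative exactly when \<open>K \<ge> 0\<close> and \<open>L = 0\<close>
  (\<open>unit_circle_form_nonneg_iff\<close>).
\<close>

text \<open>
  On the circle \<open>|z - w|\<^sup>2 = 1 + |w|\<^sup>2 - 2 (c Re w + s Im w)\<close>, and the value of this at \<open>z = 1\<close> is the
  common denominator of \<open>F1 w\<close> and \<open>F3 w\<close>.
\<close>
lemma cmod_diff_sq_unit_circle:
  assumes "cmod z = 1" and "w \<noteq> 1"
  shows "(cmod (z - w))\<^sup>2 =
    (cmod (1 - w))\<^sup>2 * (F1 w + ((1 - F1 w) * Re z + F3 w * Im z))"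
proof -
  define D where "D = (Re w - 1)\<^sup>2 + (Im w)\<^sup>2"
  have "D \<noteq> 0"
    using assms(2) by (auto simp: D_def complex_eq_iff sum_power2_eq_zero_iff)
  then have F1: "D * F1 w = D + 2 * Re w" and F3: "D * F3 w = - 2 * Im w"
    unfolding F1_def F3_def D_def[symmetric] by (simp_all add: field_simps)
  have circle: "(Re z)\<^sup>2 + (Im z)\<^sup>2 = 1"
    using assms(1) by (simp add: cmod_power2[symmetric])
  have "(cmod (1 - w))\<^sup>2 = D"
    by (simp add: cmod_power2 D_def power2_commute)
  moreover have "D * (F1 w + ((1 - F1 w) * Re z + F3 w * Im z)) =
      D * F1 w + (D - D * F1 w) * Re z + (D * F3 w) * Im z"
    by (simp add: algebra_simps)
  moreover have "\<dots> = (cmod (z - w))\<^sup>2"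
    using circle unfolding F1 F3 unfolding cmod_power2 D_def
    by simp algebra
  ultimately show ?thesis
    by simp
qed

lemma unit_circle_defect:
  fixes P :: "complex poly"
  assumes P1: "poly P 1 = 1" and roots: "proots P = {#-1, z1, z2#}" and z: "cmod z = 1"
  shows "1 - (cmod (poly P z))\<^sup>2 - (cmod (poly P (- z)))\<^sup>2 =
    Im z * (Im z * (1 - F1 z1 * F1 z2 - F3 z1 * F3 z2) - Re z * (F3 z1 + F3 z2))"
proof -
  define a where "a = lead_coeff P"
  have "P = smult a (\<Prod>x\<in>#proots P. [:- x, 1:])"
    unfolding a_def by (rule complex_poly_decompose_multiset[symmetric])
  then have factored: "P = smult a ([:1, 1:] * ([:- z1, 1:] * [:- z2, 1:]))"
    unfolding roots by simp
  have P_eq: "poly P u = a * ((u + 1) * ((u - z1) * (u - z2)))" for u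
    by (subst factored) (simp add: algebra_simps)
  have ne: "z1 \<noteq> 1" "z2 \<noteq> 1"
    using P1 P_eq[of 1] by auto
  define C where "C = (cmod a)\<^sup>2 * (cmod (1 - z1))\<^sup>2 * (cmod (1 - z2))\<^sup>2"
  have "(cmod (a * (2 * ((1 - z1) * (1 - z2)))))\<^sup>2 = 1"
    using P1 P_eq[of 1] by simp
  then have C: "C = 1 / 4"
    by (simp add: C_def norm_mult power_mult_distrib)
  define f where "f w u = F1 w + ((1 - F1 w) * Re u + F3 w * Im u)" for w u
  have P_sq: "(cmod (poly P u))\<^sup>2 = (1 + Re u) / 2 * (f z1 u * f z2 u)"
    if u: "cmod u = 1" for u
  proof -
    have "(Re u)\<^sup>2 + (Im u)\<^sup>2 = 1"
      using u by (simp add: cmod_power2[symmetric])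
    then have "(cmod (u + 1))\<^sup>2 = 2 * (1 + Re u)"
      unfolding cmod_power2 by simp algebra
    then have "(cmod (poly P u))\<^sup>2 = C * (2 * (1 + Re u) * (f z1 u * f z2 u))"
      unfolding P_eq norm_mult power_mult_distrib C_def f_def
        cmod_diff_sq_unit_circle[OF u ne(1)] cmod_diff_sq_unit_circle[OF u ne(2)]
      by simp
    then show ?thesis
      unfolding C by (simp add: field_simps)
  qed
  have "(Re z)\<^sup>2 + (Im z)\<^sup>2 = 1"
    using z by (simp add: cmod_power2[symmetric])
  then show ?thesis
    using P_sq[of z] P_sq[of "- z"] z unfolding f_def
    by simp algebra
qed

text \<open>
  Only continuity matters: the parameters \<open>t\<close> in \<open>(0, 2\<pi>)\<close> at which \<open>g (cis t)\<close> is negative form an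
  open set, and a nonempty open set of reals has positive Lebesgue measure.
\<close>
lemma AE_circle_measure_nonneg_iff:
  fixes g :: "complex \<Rightarrow> real"
  assumes cont: "continuous_on UNIV g"
  shows "(AE z in circle_measure. 0 \<le> g z) \<longleftrightarrow> (\<forall>z. cmod z = 1 \<longrightarrow> 0 \<le> g z)"
proof -
  have cis_meas: "cis \<in> restrict_space lborel {0..<2 * pi} \<rightarrow>\<^sub>M borel"
    by (intro measurable_restrict_space1)
       (simp add: borel_measurable_continuous_onI continuous_on_cis)
  have g_meas: "g \<in> borel_measurable borel"
    by (rule borel_measurable_continuous_onI[OF cont])
  have "(AE z in circle_measure. 0 \<le> g z) \<longleftrightarrow>
      (AE t in restrict_space lborel {0..<2 * pi}. 0 \<le> g (cis t))"
    unfolding circle_measure_def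
    by (rule AE_distr_iff[OF cis_meas]) (use g_meas in measurable)
  also have "\<dots> \<longleftrightarrow> (AE t in lborel. t \<in> {0..<2 * pi} \<longrightarrow> 0 \<le> g (cis t))"
    by (rule AE_restrict_space_iff) simp
  also have "\<dots> \<longleftrightarrow> (\<forall>z. cmod z = 1 \<longrightarrow> 0 \<le> g z)"
  proof
    assume ae: "AE t in lborel. t \<in> {0..<2 * pi} \<longrightarrow> 0 \<le> g (cis t)"
    have g_cis: "continuous_on S (\<lambda>t. g (cis t))" for S
      by (rule continuous_on_compose2[OF cont]) (auto intro: continuous_intros)
    define U where "U = {t. g (cis t) < 0} \<inter> {0<..<2 * pi}"
    have "open U"
      unfolding U_def by (intro open_Int open_Collect_less g_cis) auto
    have "AE t in lborel. t \<notin> U"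
      using ae by eventually_elim (auto simp: U_def)
    then have "U \<in> null_sets lborel"
      using \<open>open U\<close> by (subst AE_iff_null_sets) auto
    then have "U = {}"
      using open_not_negligible[OF \<open>open U\<close>]
      by (auto simp: negligible_iff_null_sets intro: null_sets_completionI)
    then have interior: "0 \<le> g (cis t)" if "t \<in> {0<..<2 * pi}" for t
      using that unfolding U_def by (metis Int_iff emptyE mem_Collect_eq not_less)
    have everywhere: "0 \<le> g (cis t)" if "t \<in> {0..2 * pi}" for t
      using continuous_ge_on_closure[OF g_cis, of t "{0<..<2 * pi}" 0] interior that
      by simp
    show "\<forall>z. cmod z = 1 \<longrightarrow> 0 \<le> g z"
    proof (intro allI impI)
      fix z :: complex
      assume "cmod z = 1"
      then have "z = cis (Arg2pi z)"
        using Arg2pi_eq[of z] by (simp add: cis_conv_exp)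
      moreover have "Arg2pi z \<in> {0..2 * pi}"
        using Arg2pi_ge_0[of z] Arg2pi_lt_2pi[of z] by simp
      ultimately show "0 \<le> g z"
        using everywhere by metis
    qed
  qed simp
  finally show ?thesis .
qed

lemma unit_circle_form_nonneg_iff:
  fixes K L :: real
  shows "(\<forall>z. cmod z = 1 \<longrightarrow> 0 \<le> Im z * (Im z * K - Re z * L)) \<longleftrightarrow> 0 \<le> K \<and> L = 0"
proof
  assume *: "\<forall>z. cmod z = 1 \<longrightarrow> 0 \<le> Im z * (Im z * K - Re z * L)"
  then have K: "0 \<le> K"
    by (auto dest: spec[of _ \<i>])
  \<comment> \<open>In the direction \<open>(c, s) = (K + 1, L)\<close> the form takes the value \<open>- L\<^sup>2\<close>.\<close>
  define w where "w = Complex (K + 1) L"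
  define r where "r = cmod w"
  have "w \<noteq> 0"
    using K by (simp add: w_def complex_eq_iff)
  then have r: "r > 0"
    by (simp add: r_def)
  have "cmod (w / of_real r) = 1"
    using r by (simp add: norm_divide r_def)
  with * have "0 \<le> L / r * (L / r * K - (K + 1) / r * L)"
    by (force simp: w_def)
  also have "\<dots> = - ((L / r)\<^sup>2)"
    using r by (simp add: field_simps power2_eq_square)
  finally have "L = 0"
    using r by simp
  with K show "0 \<le> K \<and> L = 0"
    by simp
qed (auto simp flip: mult.assoc)

theorem proposition2:
  fixes P :: "complex poly" and z1 z2 :: complex and A1 A2 B1 B2 :: real
  assumes "degree P = 3"
    and "poly P 1 = 1"
    and "proots P = {#-1, z1, z2#}"
    and "A1 = F1 z1" and "A2 = F1 z2" and "B1 = F3 z1" and "B2 = F3 z2"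
  shows "(AE z in circle_measure. (cmod (poly P z))\<^sup>2 + (cmod (poly P (- z)))\<^sup>2 \<le> 1) \<longleftrightarrow>
    1 - A1 * A2 - B1 * B2 \<ge> 0 \<and> B1 + B2 = 0"
proof -
  let ?g = "\<lambda>z. 1 - (cmod (poly P z))\<^sup>2 - (cmod (poly P (- z)))\<^sup>2"
  have "(AE z in circle_measure. (cmod (poly P z))\<^sup>2 + (cmod (poly P (- z)))\<^sup>2 \<le> 1) \<longleftrightarrow>
      (AE z in circle_measure. 0 \<le> ?g z)"
    by (simp add: algebra_simps)
  also have "\<dots> \<longleftrightarrow> (\<forall>z. cmod z = 1 \<longrightarrow> 0 \<le> ?g z)"
    by (rule AE_circle_measure_nonneg_iff) (intro continuous_intros)
  also have "\<dots> \<longleftrightarrow> (\<forall>z. cmod z = 1 \<longrightarrow>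
      0 \<le> Im z * (Im z * (1 - A1 * A2 - B1 * B2) - Re z * (B1 + B2)))"
    using unit_circle_defect[OF assms(2,3)] assms(4-7) by auto
  also have "\<dots> \<longleftrightarrow> 0 \<le> 1 - A1 * A2 - B1 * B2 \<and> B1 + B2 = 0"
    by (rule unit_circle_form_nonneg_iff)
  finally show ?thesis .
qed

end
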